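(* For every even integer $n>2$ there exists a 3-uniform edge-maximal hypertree $\mathcal{M}=(V,\mathcal{E})$ with $|V|=n$ and $|\mathcal{E}|=\frac{1}{2}\binom{n}{2}-\frac{1}{4}n$.
   Context: A $k$-uniform hypergraph $\mathcal{H}=(V,\mathcal{E})$ consists of a finite vertex set $V$ and a set $\mathcal{E}$ of $k$-element subsets of $V$ (no multiple edges). A $k$-uniform hypergraph is a chain if there is a sequence $v_1,\dots,v_l$ of its vertices in which every vertex appears at least once (possibly more times), $v_1\ne v_l$, and its edge set consists of exactly the $l-k+1$ distinct sets $\{v_i,\dots,v_{i+k-1}\}$, $1\le i\le l-k+1$; it is a semicycle if the same holds with $v_1=v_l$ instead. $\mathcal{H}$ is chain-connected if every pair of distinct vertices is contained in some subhypergraph that is a chain; semicycle-free if no subhypergraph is a semicycle. A hypertree is a chain-connected, semicycle-free $k$-uniform hypergraph. An edge-maximal hypertree is a hypertree $(V,\mathcal{E})$ such that for every $k$-subset $e\subseteq V$ with $e\notin\mathcal{E}$, $(V,\mathcal{E}\cup\{e\})$ is not a hypertree. *)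

theory Defs
  imports Complex_Main
begin

definition uniform_hypergraph :: "nat \<Rightarrow> 'a set \<Rightarrow> 'a set set \<Rightarrow> bool" where
  "uniform_hypergraph k V E \<longleftrightarrow> finite V \<and> (\<forall>e\<in>E. e \<subseteq> V \<and> card e = k)"

definition subhypergraph ::
  "nat \<Rightarrow> 'a set \<Rightarrow> 'a set set \<Rightarrow> 'a set \<Rightarrow> 'a set set \<Rightarrow> bool" where
  "subhypergraph k V' E' V E \<longleftrightarrow> uniform_hypergraph k V' E' \<and> V' \<subseteq> V \<and> E' \<subseteq> E"

definition window :: "nat \<Rightarrow> 'a list \<Rightarrow> nat \<Rightarrow> 'a set" where
  "window k vs i = set (take k (drop i vs))"

(* For vs = [v_1, ..., v_l], the indices i \<le> l - k (starting from 0) give exactly the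
   l - k + 1 sets {v_(i+1), ..., v_(i+k)}; injectivity says that they are distinct.
   The condition k \<le> l requires at least one edge. Without it, two vertices
   without an edge would form a chain for k = 3, and a single vertex a semicycle. *)
definition spanning_sequence :: "nat \<Rightarrow> 'a set \<Rightarrow> 'a set set \<Rightarrow> 'a list \<Rightarrow> bool" where
  "spanning_sequence k V E vs \<longleftrightarrow>
     k \<le> length vs \<and> set vs = V \<and>
     inj_on (window k vs) {..length vs - k} \<and>
     E = window k vs ` {..length vs - k}"

definition is_chain :: "nat \<Rightarrow> 'a set \<Rightarrow> 'a set set \<Rightarrow> bool" where
  "is_chain k V E \<longleftrightarrow> uniform_hypergraph k V E \<and>
     (\<exists>vs. spanning_sequence k V E vs \<and> hd vs \<noteq> last vs)"

definition is_semicycle :: "nat \<Rightarrow> 'a set \<Rightarrow> 'a set set \<Rightarrow> bool" where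
  "is_semicycle k V E \<longleftrightarrow> uniform_hypergraph k V E \<and>
     (\<exists>vs. spanning_sequence k V E vs \<and> hd vs = last vs)"

definition chain_connected :: "nat \<Rightarrow> 'a set \<Rightarrow> 'a set set \<Rightarrow> bool" where
  "chain_connected k V E \<longleftrightarrow>
     (\<forall>u\<in>V. \<forall>v\<in>V. u \<noteq> v \<longrightarrow>
       (\<exists>V' E'. subhypergraph k V' E' V E \<and> is_chain k V' E' \<and> u \<in> V' \<and> v \<in> V'))"

definition semicycle_free :: "nat \<Rightarrow> 'a set \<Rightarrow> 'a set set \<Rightarrow> bool" where
  "semicycle_free k V E \<longleftrightarrow>
     \<not> (\<exists>V' E'. subhypergraph k V' E' V E \<and> is_semicycle k V' E')"

definition hypertree :: "nat \<Rightarrow> 'a set \<Rightarrow> 'a set set \<Rightarrow> bool" where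
  "hypertree k V E \<longleftrightarrow>
     uniform_hypergraph k V E \<and> chain_connected k V E \<and> semicycle_free k V E"

definition edge_maximal_hypertree :: "nat \<Rightarrow> 'a set \<Rightarrow> 'a set set \<Rightarrow> bool" where
  "edge_maximal_hypertree k V E \<longleftrightarrow> hypertree k V E \<and>
     (\<forall>e. e \<subseteq> V \<and> card e = k \<and> e \<notin> E \<longrightarrow> \<not> hypertree k V (E \<union> {e}))"

end

theory Submission
  imports Defs
begin

text \<open>
  Split the vertices \<open>0, \<dots>, n - 1\<close> into the consecutive pairs \<open>{2i, 2i + 1}\<close> and take as edges
  each pair together with any one later vertex. Two distinct edges share two vertices only if
  these form a pair, so no sequence has three consecutive windows, whereas a semicycle needs
  them. If \<open>e = {x, y, z}\<close> is a non-edge with least vertex \<open>x\<close> and \<open>x'\<close> is the partner of \<open>x\<close>,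
  then \<open>y, x', x, z, y\<close> is a semicycle in the hypergraph extended by \<open>e\<close>.
\<close>

section \<open>The hypergraph of pairs and its edge count\<close>

definition pair_edges :: "nat \<Rightarrow> nat set set" where
  "pair_edges n = {{2 * i, 2 * i + 1, x} | i x. 2 * i + 2 \<le> x \<and> x < n}"

lemma pair_partner:
  fixes p :: nat
  shows "\<exists>q. q div 2 = p div 2 \<and> q \<noteq> p"
proof (cases "even p")
  case True
  then show ?thesis
    by (intro exI [of _ "p + 1"]) auto
next
  case False
  then show ?thesis
    by (intro exI [of _ "p - 1"]) (auto elim!: oddE)
qed

text \<open>Two distinct vertices form a pair exactly when \<open>div 2\<close> agrees on them.
  Phrased this way, the pair may be given in either order, and "later vertex" becomes a comparison
  of quotients.\<close>

lemma pair_edgesI: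
  assumes "p div 2 = q div 2" "p \<noteq> q" "p div 2 < x div 2" "x < n"
  shows "{p, q, x} \<in> pair_edges n"
proof -
  have "{p, q} = {2 * (p div 2), 2 * (p div 2) + 1}"
    using assms(1,2) by (cases "even p"; cases "even q"; auto elim!: evenE oddE)
  then have "{p, q, x} = {2 * (p div 2), 2 * (p div 2) + 1, x}"
    by auto
  moreover have "2 * (p div 2) + 2 \<le> x"
    using assms(3) by presburger
  ultimately show ?thesis
    using assms(4) unfolding pair_edges_def by blast
qed

lemma card_pair_edge: "e \<in> pair_edges n \<Longrightarrow> card e = 3"
  unfolding pair_edges_def by (auto simp: card_insert_if)

lemma pair_edge_subset: "e \<in> pair_edges n \<Longrightarrow> e \<subseteq> {..<n}"
  unfolding pair_edges_def by auto

lemma uniform_pair_edges: "uniform_hypergraph 3 {..<n} (pair_edges n)"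
  unfolding uniform_hypergraph_def using card_pair_edge pair_edge_subset by blast

lemma card_pair_edges: "card (pair_edges (2 * m)) = m * (m - 1)"
proof -
  let ?S = "SIGMA i:{..<m}. {2 * i + 2..<2 * m}"
  let ?f = "\<lambda>(i, x). {2 * i, 2 * i + 1, x :: nat}"
  have "pair_edges (2 * m) = ?f ` ?S"
  proof (intro equalityI subsetI)
    fix e assume "e \<in> pair_edges (2 * m)"
    then obtain i x where e: "e = {2 * i, 2 * i + 1, x}" and "2 * i + 2 \<le> x" "x < 2 * m"
      unfolding pair_edges_def by blast
    then have "(i, x) \<in> ?S"
      by auto
    then show "e \<in> ?f ` ?S"
      unfolding e by (rule rev_image_eqI) simp
  next
    fix e assume "e \<in> ?f ` ?S"
    then obtain i x where "e = {2 * i, 2 * i + 1, x}" "2 * i + 2 \<le> x" "x < 2 * m"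
      by auto
    then show "e \<in> pair_edges (2 * m)"
      unfolding pair_edges_def by blast
  qed
  moreover have "inj_on ?f ?S"
  proof (rule inj_onI, clarify)
    fix i x j y :: nat
    assume x: "x \<in> {2 * i + 2..<2 * m}" and y: "y \<in> {2 * j + 2..<2 * m}"
      and eq: "{2 * i, 2 * i + 1, x} = {2 * j, 2 * j + 1, y}"
    \<comment> \<open>Since x is at least 2i + 2, an edge determines its parameters: 2i is its
      minimum and x its maximum.\<close>
    have "Min {2 * i, 2 * i + 1, x} = 2 * i" "Min {2 * j, 2 * j + 1, y} = 2 * j"
      "Max {2 * i, 2 * i + 1, x} = x" "Max {2 * j, 2 * j + 1, y} = y"
      using x y by auto
    then have "2 * i = 2 * j" "x = y"
      using arg_cong [OF eq, of Min] arg_cong [OF eq, of Max] by (simp_all only:)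
    then show "i = j \<and> x = y"
      by simp
  qed
  ultimately have "card (pair_edges (2 * m)) = (\<Sum>i<m. 2 * m - (2 * i + 2))"
    by (simp add: card_image)
  \<comment> \<open>Reversing the index, i to m - 1 - i, turns the summand 2m - (2i + 2) into
    2i.\<close>
  also have "\<dots> = (\<Sum>i<m. 2 * i)"
    by (subst sum.nat_diff_reindex [symmetric]) (intro sum.cong, auto)
  also have "\<dots> = m * (m - 1)"
    by (induction m) (auto simp: algebra_simps)
  finally show ?thesis .
qed

section \<open>Absence of semicycles\<close>

lemma pair_edges_inter:
  assumes "e \<in> pair_edges n" "f \<in> pair_edges n" "e \<noteq> f"
    and "b \<in> e" "b \<in> f" "c \<in> e" "c \<in> f"
  shows "b div 2 = c div 2"
proof -
  obtain i x where e: "e = {2 * i, 2 * i + 1, x}" "2 * i + 2 \<le> x"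
    using assms(1) unfolding pair_edges_def by blast
  obtain j y where f: "f = {2 * j, 2 * j + 1, y}" "2 * j + 2 \<le> y"
    using assms(2) unfolding pair_edges_def by blast
  have neq: "\<not> (i = j \<and> x = y)"
    using e f assms(3) by blast
  have mem: "b = 2 * i \<or> b = 2 * i + 1 \<or> b = x" "c = 2 * i \<or> c = 2 * i + 1 \<or> c = x"
    "b = 2 * j \<or> b = 2 * j + 1 \<or> b = y" "c = 2 * j \<or> c = 2 * j + 1 \<or> c = y"
    using e f assms(4-7) by auto
  \<comment> \<open>If one edge has the earlier pair, the other edge lies entirely beyond that pair,
    so the only possible common vertex is the extra vertex of the first edge, and b = c. If the
    pairs agree, the extra vertices differ, so b and c both belong to the pair.\<close>
  show ?thesis
  proof (cases i j rule: linorder_cases)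
    case less
    then have "b = x" "c = x"
      using mem f(2) by linarith+
    then show ?thesis
      by simp
  next
    case equal
    then have "b = 2 * i \<or> b = 2 * i + 1" "c = 2 * i \<or> c = 2 * i + 1"
      using neq mem e(2) by auto
    then show ?thesis
      by auto
  next
    case greater
    then have "b = y" "c = y"
      using mem e(2) by linarith+
    then show ?thesis
      by simp
  qed
qed

lemma window_3:
  assumes "i + 2 < length vs"
  shows "window 3 vs i = {vs ! i, vs ! (i + 1), vs ! (i + 2)}"
proof -
  have "drop i vs = vs ! i # vs ! (i + 1) # vs ! (i + 2) # drop (i + 3) vs"
    using assms by (simp add: Cons_nth_drop_Suc numeral_3_eq_3)
  then show ?thesis
    by (simp add: window_def)
qed

text \<open>This guarantees three consecutive windows. With equal ends, a sequence of length 3 gives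
  a window with a repeated vertex, hence fewer than three elements; in one of length 4 the two
  windows coincide as sets, against injectivity.\<close>

lemma semicycle_3_length:
  assumes "uniform_hypergraph 3 V E" "spanning_sequence 3 V E vs" "hd vs = last vs"
  shows "5 \<le> length vs"
proof (rule ccontr)
  assume "\<not> 5 \<le> length vs"
  moreover have len: "3 \<le> length vs"
    and inj: "inj_on (window 3 vs) {..length vs - 3}"
    and E: "E = window 3 vs ` {..length vs - 3}"
    using assms(2) unfolding spanning_sequence_def by auto
  ultimately consider "length vs = 3" | "length vs = 4"
    by linarith
  moreover have "vs \<noteq> []"
    using len by auto
  then have ends: "vs ! 0 = vs ! (length vs - 1)"
    using assms(3) by (simp add: hd_conv_nth last_conv_nth)
  ultimately show False
  proof cases
    case 1
    have "card (window 3 vs 0) = 3"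
      using assms(1) E unfolding uniform_hypergraph_def by auto
    then show False
      using 1 ends by (simp add: window_3 card_insert_if numeral_2_eq_2 split: if_splits)
  next
    case 2
    have "window 3 vs 0 = window 3 vs 1"
      using 2 ends window_3 [of 0 vs] window_3 [of 1 vs]
      by (simp add: numeral_2_eq_2 numeral_3_eq_3 insert_commute)
    then show False
      using inj 2 by (auto dest: inj_onD)
  qed
qed

lemma semicycle_free_pair_edges: "semicycle_free 3 {..<n} (pair_edges n)"
  unfolding semicycle_free_def
proof clarify
  fix V E
  assume "subhypergraph 3 V E {..<n} (pair_edges n)" "is_semicycle 3 V E"
  then obtain vs where sub: "E \<subseteq> pair_edges n" and unif: "uniform_hypergraph 3 V E"
    and span: "spanning_sequence 3 V E vs" and ends: "hd vs = last vs"
    unfolding subhypergraph_def is_semicycle_def by blast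
  have len: "5 \<le> length vs"
    using semicycle_3_length [OF unif span ends] .
  have inj: "inj_on (window 3 vs) {..length vs - 3}"
    and E: "E = window 3 vs ` {..length vs - 3}"
    using span unfolding spanning_sequence_def by auto
  have edge: "window 3 vs i \<in> pair_edges n" if "i < 3" for i
    using that len sub E by auto
  have neq: "window 3 vs 0 \<noteq> window 3 vs 1" "window 3 vs 1 \<noteq> window 3 vs 2"
    using inj len by (auto simp: inj_on_eq_iff)
  have win: "window 3 vs 0 = {vs ! 0, vs ! 1, vs ! 2}" "window 3 vs 1 = {vs ! 1, vs ! 2, vs ! 3}"
    "window 3 vs 2 = {vs ! 2, vs ! 3, vs ! 4}"
    using len window_3 [of 0 vs] window_3 [of 1 vs] window_3 [of 2 vs]
    by (simp_all add: eval_nat_numeral)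
  \<comment> \<open>The middle window shares its first two vertices with the window before it and
    its last two with the window after it. So its three distinct vertices would all lie in one
    pair.\<close>
  have "vs ! 1 div 2 = vs ! 2 div 2"
    by (rule pair_edges_inter [OF edge [of 0] edge [of 1] neq(1)]) (simp_all add: win del: One_nat_def)
  moreover have "vs ! 2 div 2 = vs ! 3 div 2"
    by (rule pair_edges_inter [OF edge [of 1] edge [of 2] neq(2)]) (simp_all add: win del: One_nat_def)
  moreover have "card {vs ! 1, vs ! 2, vs ! 3} = 3"
    using card_pair_edge [OF edge [of 1]] by (simp add: win del: One_nat_def)
  then have "vs ! 1 \<noteq> vs ! 2 \<and> vs ! 1 \<noteq> vs ! 3 \<and> vs ! 2 \<noteq> vs ! 3"
    by (auto simp: card_insert_if split: if_splits)
  moreover have "p = q \<or> q = r \<or> p = r" if "p div 2 = q div 2" "q div 2 = r div 2" for p q r :: nat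
    using that by (cases "even p"; cases "even q"; cases "even r") (auto elim!: evenE oddE)
  ultimately show False
    by blast
qed

section \<open>Short chains and semicycles, and chain-connectedness\<close>

lemma is_chain_single_edge:
  assumes "distinct [a, b, c]"
  shows "is_chain 3 {a, b, c} {{a, b, c}}"
proof -
  have "spanning_sequence 3 {a, b, c} {{a, b, c}} [a, b, c]"
    by (simp add: spanning_sequence_def window_def)
  then show ?thesis
    using assms unfolding is_chain_def uniform_hypergraph_def
    by (intro conjI exI [of _ "[a, b, c]"]) auto
qed

lemma is_chain_two_edges:
  assumes "distinct [a, b, c, d]"
  shows "is_chain 3 {a, b, c, d} {{a, b, c}, {b, c, d}}"
proof -
  let ?vs = "[a, b, c, d]"
  have win: "window 3 ?vs 0 = {a, b, c}" "window 3 ?vs 1 = {b, c, d}"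
    by (simp_all add: window_def)
  have idx: "{..length ?vs - 3} = {0, 1}"
    by auto
  have "a \<notin> {b, c, d}"
    using assms by simp
  then have "{a, b, c} \<noteq> {b, c, d}"
    by blast
  then have "inj_on (window 3 ?vs) {0, 1}"
    using win by simp
  then have "spanning_sequence 3 {a, b, c, d} {{a, b, c}, {b, c, d}} ?vs"
    unfolding spanning_sequence_def idx by (simp add: win [simplified])
  moreover have "uniform_hypergraph 3 {a, b, c, d} {{a, b, c}, {b, c, d}}"
    using assms by (simp add: uniform_hypergraph_def)
  moreover have "hd ?vs \<noteq> last ?vs"
    using assms by simp
  ultimately show ?thesis
    unfolding is_chain_def by blast
qed

lemma is_semicycle_three_edges:
  assumes "distinct [a, b, c, d]"
  shows "is_semicycle 3 {a, b, c, d} {{a, b, c}, {b, c, d}, {c, d, a}}"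
proof -
  let ?vs = "[a, b, c, d, a]"
  have win: "window 3 ?vs 0 = {a, b, c}" "window 3 ?vs 1 = {b, c, d}" "window 3 ?vs 2 = {c, d, a}"
    by (simp_all add: window_def)
  have idx: "{..length ?vs - 3} = {0, 1, 2}"
    by auto
  \<comment> \<open>The vertex a is missing only from the second window and b only from the third,
    which separates all three.\<close>
  have "a \<notin> {b, c, d}" "b \<notin> {c, d, a}"
    using assms by auto
  then have "{a, b, c} \<noteq> {b, c, d}" "{a, b, c} \<noteq> {c, d, a}" "{b, c, d} \<noteq> {c, d, a}"
    by blast+
  then have "inj_on (window 3 ?vs) {0, 1, 2}"
    using win by (simp add: eq_commute)
  then have "spanning_sequence 3 {a, b, c, d} {{a, b, c}, {b, c, d}, {c, d, a}} ?vs"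
    unfolding spanning_sequence_def idx by (simp add: win [simplified] insert_commute)
  moreover have "uniform_hypergraph 3 {a, b, c, d} {{a, b, c}, {b, c, d}, {c, d, a}}"
    using assms by (auto simp: uniform_hypergraph_def)
  moreover have "hd ?vs = last ?vs"
    by simp
  ultimately show ?thesis
    unfolding is_semicycle_def by blast
qed

text \<open>Vertices of different pairs share an edge: the smaller one, its partner and the larger
  one. The pair 0, 1 lies in {0, 1, 2}, available since n > 2. Any other pair u, v is joined by the
  sequence u, 0, 1, v.\<close>

lemma chain_connected_pair_edges:
  assumes "2 < n"
  shows "chain_connected 3 {..<n} (pair_edges n)"
proof -
  define conn where "conn u v \<longleftrightarrow> (\<exists>V E. subhypergraph 3 V E {..<n} (pair_edges n) \<and>
    is_chain 3 V E \<and> u \<in> V \<and> v \<in> V)" for u v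
  have edge: "conn u v" if "{a, b, c} \<in> pair_edges n" "u \<in> {a, b, c}" "v \<in> {a, b, c}" for a b c u v
  proof -
    have "distinct [a, b, c]"
      using card_pair_edge [OF that(1)] by (auto simp: card_insert_if split: if_splits)
    then have "is_chain 3 {a, b, c} {{a, b, c}}"
      by (rule is_chain_single_edge)
    moreover have "subhypergraph 3 {a, b, c} {{a, b, c}} {..<n} (pair_edges n)"
      using that(1) uniform_pair_edges [of n] calculation
      unfolding subhypergraph_def is_chain_def uniform_hypergraph_def by auto
    ultimately show ?thesis
      using that(2,3) unfolding conn_def by blast
  qed
  have less: "conn u v" if "u < v" "v < n" for u v
  proof -
    have "u div 2 \<le> v div 2"
      using \<open>u < v\<close> by (simp add: div_le_mono)
    then consider "u div 2 < v div 2" | "u div 2 = v div 2" "u < 2" | "u div 2 = v div 2" "2 \<le> u"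
      by linarith
    then show ?thesis
    proof cases
      case 1
      obtain u' where "u' div 2 = u div 2" "u' \<noteq> u"
        using pair_partner by blast
      then have "{u, u', v} \<in> pair_edges n"
        using 1 that by (intro pair_edgesI) simp_all
      then show ?thesis
        by (rule edge) auto
    next
      case 2
      then have "u = 0" "v = 1"
        using \<open>u < v\<close> by auto
      have "{0, 1, 2} \<in> pair_edges n"
        using assms by (intro pair_edgesI) auto
      then show ?thesis
        by (rule edge) (simp_all add: \<open>u = 0\<close> \<open>v = 1\<close>)
    next
      case 3
      have "{0, 1, u} \<in> pair_edges n" "{0, 1, v} \<in> pair_edges n"
        using 3 that by (intro pair_edgesI; linarith)+
      then have edges: "{u, 0, 1} \<in> pair_edges n" "{0, 1, v} \<in> pair_edges n"
        by (simp_all add: insert_commute)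
      have "is_chain 3 {u, 0, 1, v} {{u, 0, 1}, {0, 1, v}}"
        using 3 that by (intro is_chain_two_edges) auto
      moreover have "subhypergraph 3 {u, 0, 1, v} {{u, 0, 1}, {0, 1, v}} {..<n} (pair_edges n)"
        using edges that 3 calculation unfolding subhypergraph_def is_chain_def by auto
      ultimately show ?thesis
        unfolding conn_def by blast
    qed
  qed
  have sym: "conn u v \<Longrightarrow> conn v u" for u v
    unfolding conn_def by blast
  have "conn u v" if "u < n" "v < n" "u \<noteq> v" for u v
    using that less [of u v] less [of v u] sym by (cases u v rule: linorder_cases) auto
  then show ?thesis
    unfolding chain_connected_def conn_def by auto
qed

section \<open>Edge-maximality\<close>

lemma not_semicycle_free_insert_pair_edges:
  assumes e: "e \<subseteq> {..<n}" "card e = 3" "e \<notin> pair_edges n"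
  shows "\<not> semicycle_free 3 {..<n} (pair_edges n \<union> {e})"
proof -
  define x where "x = Min e"
  have fin: "finite e" "e \<noteq> {}"
    using e(2) by (auto intro: card_ge_0_finite)
  have "x \<in> e"
    using fin unfolding x_def by (rule Min_in)
  then have "card (e - {x}) = 2"
    using e(2) by simp
  then obtain y z where yz: "e - {x} = {y, z}" "y \<noteq> z"
    unfolding card_2_iff by blast
  then have e_eq: "e = {x, y, z}"
    using \<open>x \<in> e\<close> by blast
  have "x \<le> y" "x \<le> z" "x \<noteq> y" "x \<noteq> z"
    using fin(1) yz unfolding x_def by (auto simp: e_eq)
  then have less: "x < y" "x < z"
    by auto
  have bound: "y < n" "z < n"
    using e(1) e_eq by auto
  \<comment> \<open>Otherwise y is the partner of x. A pair has only two vertices, so z then lies in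
    a later pair and e would be an edge. The argument for z is the same, with y already known to lie
    in a later pair.\<close>
  have y: "x div 2 < y div 2"
  proof (rule ccontr)
    assume "\<not> x div 2 < y div 2"
    then have "x div 2 = y div 2"
      using less(1) div_le_mono [of x y 2] by linarith
    moreover from this have "x div 2 < z div 2"
      using less yz(2) by linarith
    ultimately have "{x, y, z} \<in> pair_edges n"
      using less(1) bound by (intro pair_edgesI) auto
    then show False
      using e(3) e_eq by simp
  qed
  have z: "x div 2 < z div 2"
  proof (rule ccontr)
    assume "\<not> x div 2 < z div 2"
    then have "x div 2 = z div 2"
      using less(2) div_le_mono [of x z 2] by linarith
    then have "{x, z, y} \<in> pair_edges n"
      using y less(2) bound by (intro pair_edgesI) auto
    moreover have "{x, z, y} = e"
      using e_eq by blast
    ultimately show False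
      using e(3) by simp
  qed
  obtain x' where x': "x' div 2 = x div 2" "x' \<noteq> x"
    using pair_partner by blast
  have edges: "{x', x, y} \<in> pair_edges n" "{x', x, z} \<in> pair_edges n"
    using x' y z bound by (intro pair_edgesI; simp)+
  \<comment> \<open>The first two sets are old edges, extending the pair of x by y and by z; the
    third is e itself.\<close>
  let ?V = "{y, x', x, z}" and ?E = "{{y, x', x}, {x', x, z}, {x, z, y}}"
  have semi: "is_semicycle 3 ?V ?E"
    using x' y z yz(2) by (intro is_semicycle_three_edges) auto
  have "{y, x', x} \<in> pair_edges n"
    using edges(1) by (simp add: insert_commute)
  moreover have "{x, z, y} = e"
    using e_eq by blast
  ultimately have E: "?E \<subseteq> pair_edges n \<union> {e}"
    using edges(2) by (simp only: insert_subset Un_iff singleton_iff empty_subsetI simp_thms)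
  \<comment> \<open>The bound on \<open>x'\<close> comes from an edge that contains it.\<close>
  have "{x', x, y} \<subseteq> {..<n}"
    using edges(1) by (rule pair_edge_subset)
  then have "?V \<subseteq> {..<n}"
    using bound(2) by simp
  with E have "subhypergraph 3 ?V ?E {..<n} (pair_edges n \<union> {e})"
    using semi unfolding subhypergraph_def is_semicycle_def by blast
  with semi show ?thesis
    unfolding semicycle_free_def by blast
qed

theorem theorem12:
  fixes n :: nat
  assumes "even n" and "n > 2"
  shows "\<exists>(V :: nat set) (E :: nat set set).
           edge_maximal_hypertree 3 V E \<and> card V = n \<and>
           real (card E) = 1 / 2 * real (n choose 2) - 1 / 4 * real n"
proof (intro exI conjI)
  show "edge_maximal_hypertree 3 {..<n} (pair_edges n)"
    using uniform_pair_edges chain_connected_pair_edges [OF assms(2)] semicycle_free_pair_edges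
      not_semicycle_free_insert_pair_edges
    unfolding edge_maximal_hypertree_def hypertree_def by blast
  show "card {..<n} = n"
    by simp
  obtain m where n: "n = 2 * m"
    using assms(1) by (elim evenE)
  have "m \<ge> 1"
    using n assms(2) by simp
  then have "real (card (pair_edges n)) = real m * (real m - 1)"
    by (simp add: n card_pair_edges of_nat_diff)
  \<comment> \<open>With n = 2m the claimed count is m(2m - 1)/2 - m/2 = m(m - 1).\<close>
  moreover have "n choose 2 = m * (2 * m - 1)"
    by (simp add: n choose_two)
  then have "real (n choose 2) = real m * (2 * real m - 1)"
    using \<open>m \<ge> 1\<close> by (simp add: of_nat_diff)
  ultimately show "real (card (pair_edges n)) = 1 / 2 * real (n choose 2) - 1 / 4 * real n"
    by (simp add: n algebra_simps)
qed

end
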